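(* For $\alpha\in(0,1)$ let $(\mu_t)_{t\ge0}$ be Frozen-Boundary Diffusion with parameter $\alpha$, with boundary $\beta_t=\beta_t(\alpha)$ and rescaled measures $\tilde\mu_t=\tilde\mu_t(\alpha)$. Suppose that for every $\alpha\in(0,1)$ there exists a probability measure $\mu_\infty(\alpha)$ on $\mathbb{R}$ such that $\tilde\mu_t(\alpha)$ converges weakly to $\mu_\infty(\alpha)$ as $t\to\infty$. Then for every $\alpha\in(0,1)$ there exists $\ell_\alpha>0$ such that $$\lim_{t\to\infty}\frac{\beta_t(\alpha)}{\sqrt{t}}=\ell_\alpha.$$
   Context: Fix $\alpha\in(0,1)$. Frozen-Boundary Diffusion with parameter $\alpha$ is the deterministic sequence $(\mu_t)_{t=0,1,2,\ldots}$ of symmetric probability distributions on $\mathbb{Z}$ defined recursively as follows. Let $\mu_0=\delta(0)$ be the unit point mass at $0$. Given $\mu_t$, the boundary is $$\beta_t:=\sup\{x\in\mathbb{Z}:\ \mu_t([x,\infty))\ge \tfrac{\alpha}{2}\}.$$ The frozen mass $f_t$ consists of the leftmost mass $\alpha/2$ and the rightmost mass $\alpha/2$ of $\mu_t$. Explicitly, if $\beta_t>0$, then for $y\ge 0$ $$f_t(y)=\begin{cases}\mu_t(y), & y>\beta_t,\\ \frac{\alpha}{2}-\sum_{z>\beta_t}\mu_t(z), & y=\beta_t,\\ 0, & 0\le y<\beta_t,\end{cases}$$ and $f_t(y)=f_t(-y)$ for $y<0$. If $\beta_t=0$, then $f_t(y)=\mu_t(y)$ for $y\neq 0$ and $f_t(0)=\alpha-2\sum_{z>0}\mu_t(z)$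 (contributions from both sides). Thus $f_t$ has total mass $\alpha$. The free mass is $\nu_t:=\mu_t-f_t$, of total mass $1-\alpha$. The next distribution is $$\mu_{t+1}(x)=\frac{\nu_t(x-1)+\nu_t(x+1)}{2}+f_t(x),\qquad x\in\mathbb{Z}.$$ Viewing $\mu_t$ as a measure on $\mathbb{R}$, for $t\ge 1$ the rescaled measure $\tilde\mu_t$ is the Borel probability measure on $\mathbb{R}$ given by $\tilde\mu_t(A)=\mu_t(\{y\sqrt{t}: y\in A\})$ for Borel sets $A$. *)

theory Defs
  imports "HOL-Probability.Probability"
begin

text \<open>
  A distribution on the integers is represented by its mass function. The boundary is a supremum
  in \<^typ>\<open>int\<close>, which is only conditionally complete; for a symmetric probability mass
  function and \<open>0 < \<alpha> < 1\<close> the set below contains 0 and is bounded above.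
\<close>

definition boundary :: "real \<Rightarrow> (int \<Rightarrow> real) \<Rightarrow> int" where
  "boundary \<alpha> \<mu> = Sup {x. (\<Sum>\<^sub>\<infinity>z\<in>{x..}. \<mu> z) \<ge> \<alpha> / 2}"

text \<open>
  The values at negative arguments are obtained by reflection, hence the absolute value.
  The last branch is the case of boundary 0, since the boundary is never negative for the
  distributions considered here.
\<close>

definition frozen_mass :: "real \<Rightarrow> (int \<Rightarrow> real) \<Rightarrow> int \<Rightarrow> real" where
  "frozen_mass \<alpha> \<mu> y =
    (let b = boundary \<alpha> \<mu> in
     if b > 0 then
       (if \<bar>y\<bar> > b then \<mu> \<bar>y\<bar>
        else if \<bar>y\<bar> = b then \<alpha> / 2 - (\<Sum>\<^sub>\<infinity>z\<in>{b<..}. \<mu> z)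
        else 0)
     else
       (if y \<noteq> 0 then \<mu> y else \<alpha> - 2 * (\<Sum>\<^sub>\<infinity>z\<in>{0<..}. \<mu> z)))"

definition free_mass :: "real \<Rightarrow> (int \<Rightarrow> real) \<Rightarrow> int \<Rightarrow> real" where
  "free_mass \<alpha> \<mu> x = \<mu> x - frozen_mass \<alpha> \<mu> x"

primrec fbd :: "real \<Rightarrow> nat \<Rightarrow> int \<Rightarrow> real" where
  "fbd \<alpha> 0 = (\<lambda>x. if x = 0 then 1 else 0)"
| "fbd \<alpha> (Suc t) = (\<lambda>x. (free_mass \<alpha> (fbd \<alpha> t) (x - 1) + free_mass \<alpha> (fbd \<alpha> t) (x + 1)) / 2
                          + frozen_mass \<alpha> (fbd \<alpha> t) x)"

definition fbd_boundary :: "real \<Rightarrow> nat \<Rightarrow> int" where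
  "fbd_boundary \<alpha> t = boundary \<alpha> (fbd \<alpha> t)"

text \<open>
  For \<open>t \<ge> 1\<close> the preimage of a Borel set \<open>A\<close> under \<open>x \<mapsto> x / sqrt t\<close> consists of the integers
  of the form \<open>y * sqrt t\<close> with \<open>y \<in> A\<close>. The value at \<open>t = 0\<close> is irrelevant for limits.
\<close>

definition fbd_rescaled :: "real \<Rightarrow> nat \<Rightarrow> real measure" where
  "fbd_rescaled \<alpha> t =
     distr (point_measure UNIV (\<lambda>x. ennreal (fbd \<alpha> t x))) borel
       (\<lambda>x. real_of_int x / sqrt (real t))"

end

theory Submission
  imports Defs "HOL-Real_Asymp.Real_Asymp"
begin

text \<open>
  Frozen mass does not move, so the mass \<open>\<alpha> / 2\<close> frozen at or beyond the boundary is still there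
  one step later, and the boundary never retreats. Free mass lives on the integers of absolute
  value at most \<open>\<beta>\<^sub>t\<close> and moves by one, so by induction \<open>\<mu>\<^sub>t\<close> vanishes outside
  \<open>{- \<beta>\<^sub>t - 1..\<beta>\<^sub>t + 1}\<close> (\<open>fbd_outside\<close>). Two consequences settle the matter.

  First, the boundary cannot be small: a simple random walk step raises the second moment by the mass
  that moves, so \<open>\<mu>\<^sub>t\<close> has second moment \<open>(1 - \<alpha>) t\<close>, and this is at most
  \<open>(\<beta>\<^sub>t + 1)\<^sup>2\<close> (\<open>fbd_boundary_lower\<close>). Any limit of \<open>\<beta>\<^sub>t / sqrt t\<close> is therefore at least
  \<open>sqrt (1 - \<alpha>) > 0\<close>.

  Second, \<open>\<mu>\<^sub>t\<close> carries mass at least \<open>\<alpha> / 2\<close> on the two topmost sites \<open>\<beta>\<^sub>t\<close> and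
  \<open>\<beta>\<^sub>t + 1\<close> of its range. After rescaling these sites merge, so the right end of the support is
  an atom of mass at least \<open>\<alpha> / 2\<close> in the limit. If \<open>\<beta>\<^sub>t / sqrt t\<close> had two limit points
  \<open>p < q\<close>, the times belonging to \<open>p\<close> would show that the weak limit has no mass to the right of
  \<open>p\<close>, and those belonging to \<open>q\<close> that it has mass at least \<open>\<alpha> / 2\<close> at or beyond every
  point to the left of \<open>q\<close>, a contradiction; and the limit points are finite, since otherwise mass
  \<open>\<alpha> / 2\<close> would escape to infinity. In \<open>convergent_of_edge_atom\<close> this is carried
  out with distribution functions.
\<close>

section \<open>Symmetric distributions on the integers\<close>

lemma sum_symmetric_interval:
  fixes h :: "int \<Rightarrow> real"
  assumes "\<And>x. h (- x) = h x" and "0 \<le> M"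
  shows "(\<Sum>x\<in>{-M..M}. h x) = h 0 + 2 * (\<Sum>x\<in>{0<..M}. h x)"
proof -
  have "{-M..M} = {-M..<0} \<union> ({0} \<union> {0<..M})"
    using assms(2) by auto
  then have "(\<Sum>x\<in>{-M..M}. h x) = (\<Sum>x\<in>{-M..<0}. h x) + (h 0 + (\<Sum>x\<in>{0<..M}. h x))"
    by (simp only:) (subst sum.union_disjoint; force)+
  moreover have "(\<Sum>x\<in>{-M..<0}. h x) = (\<Sum>x\<in>{0<..M}. h x)"
    by (rule sum.reindex_bij_witness[of _ uminus uminus]) (auto simp: assms)
  ultimately show ?thesis by simp
qed

text \<open>
  The radius \<open>N\<close> is a crude bound on the support that turns all sums into finite ones. It
  grows by one with every step of the diffusion, independently of the boundary.
\<close>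

locale symmetric_distribution =
  fixes N :: int and \<mu> :: "int \<Rightarrow> real"
  assumes nonneg: "0 \<le> \<mu> x"
    and symmetric: "\<mu> (- x) = \<mu> x"
    and outside: "N < \<bar>x\<bar> \<Longrightarrow> \<mu> x = 0"
    and total: "(\<Sum>x\<in>{-N..N}. \<mu> x) = 1"
begin

lemma radius_nonneg: "0 \<le> N"
  using total by (cases "0 \<le> N") auto

lemma tail_eq_sum: "(\<Sum>\<^sub>\<infinity>z\<in>{x..}. \<mu> z) = (\<Sum>z\<in>{x..N}. \<mu> z)"
proof -
  have "(\<Sum>\<^sub>\<infinity>z\<in>{x..}. \<mu> z) = (\<Sum>\<^sub>\<infinity>z\<in>{x..N}. \<mu> z)"
    by (rule infsum_cong_neutral) (use outside in auto)
  then show ?thesis by simp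
qed

lemma tail_eq_sum': "(\<Sum>\<^sub>\<infinity>z\<in>{x<..}. \<mu> z) = (\<Sum>z\<in>{x<..N}. \<mu> z)"
proof -
  have "{x<..} = {x+1..}" "{x<..N} = {x+1..N}" by auto
  then show ?thesis by (simp only: tail_eq_sum)
qed

end

section \<open>One step of the diffusion\<close>

definition fbd_step :: "real \<Rightarrow> (int \<Rightarrow> real) \<Rightarrow> int \<Rightarrow> real" where
  "fbd_step \<alpha> \<mu> x =
    (free_mass \<alpha> \<mu> (x - 1) + free_mass \<alpha> \<mu> (x + 1)) / 2 + frozen_mass \<alpha> \<mu> x"

locale frozen_boundary = symmetric_distribution +
  fixes \<alpha> :: real
  assumes \<alpha>_pos: "0 < \<alpha>" and \<alpha>_less_1: "\<alpha> < 1"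
begin

abbreviation b :: int where "b \<equiv> boundary \<alpha> \<mu>"

text \<open>
  The supremum that defines the boundary is attained, since the tail vanishes beyond \<open>N\<close>. It is not
  negative because symmetry puts mass at least \<open>1 / 2 > \<alpha> / 2\<close> on \<open>{0..}\<close>.
\<close>

lemma
  shows tail_boundary: "\<alpha> / 2 \<le> (\<Sum>z\<in>{b..N}. \<mu> z)"
    and tail_imp_le_boundary: "\<alpha> / 2 \<le> (\<Sum>z\<in>{x..N}. \<mu> z) \<Longrightarrow> x \<le> b"
    and boundary_nonneg: "0 \<le> b"
    and tail_beyond_boundary: "(\<Sum>z\<in>{b<..N}. \<mu> z) < \<alpha> / 2"
proof -
  define X where "X = {x. \<alpha> / 2 \<le> (\<Sum>z\<in>{x..N}. \<mu> z)}"
  have b: "b = Sup X"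
    by (simp add: boundary_def X_def tail_eq_sum)
  have split0: "{0..N} = insert 0 {0<..N}" using radius_nonneg by auto
  have "1 = \<mu> 0 + 2 * (\<Sum>z\<in>{0<..N}. \<mu> z)"
    using sum_symmetric_interval[of \<mu> N] symmetric radius_nonneg total by simp
  with nonneg[of 0] have "1 / 2 \<le> (\<Sum>z\<in>{0..N}. \<mu> z)"
    by (simp add: split0)
  with \<alpha>_less_1 have X0: "0 \<in> X"
    by (simp add: X_def)
  have XN: "x \<le> N" if "x \<in> X" for x
    using that \<alpha>_pos by (cases "x \<le> N") (auto simp: X_def)
  have "bdd_above X" using XN by (rule bdd_aboveI)
  then have max: "x \<le> b" if "x \<in> X" for x
    unfolding b using that by (rule cSup_upper[rotated])
  have "b \<in> X"
  proof -
    have "finite (X \<inter> {0..N})" "X \<inter> {0..N} \<noteq> {}"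
      using X0 radius_nonneg by auto
    define m where "m = Max (X \<inter> {0..N})"
    have m: "m \<in> X" "\<And>x. x \<in> X \<Longrightarrow> x \<le> m"
    proof -
      show "m \<in> X"
        using Max_in[OF \<open>finite _\<close> \<open>_ \<noteq> {}\<close>] by (simp add: m_def)
      fix x assume "x \<in> X"
      show "x \<le> m"
      proof (cases "0 \<le> x")
        case True
        then show ?thesis
          using XN[OF \<open>x \<in> X\<close>] \<open>x \<in> X\<close> unfolding m_def by (intro Max_ge) auto
      next
        case False
        moreover have "0 \<le> m"
          unfolding m_def using X0 radius_nonneg by (intro Max_ge) auto
        ultimately show ?thesis by simp
      qed
    qed
    then have "Sup X = m" by (intro cSup_eq_maximum)
    with m b show ?thesis by simp
  qed
  then show "\<alpha> / 2 \<le> (\<Sum>z\<in>{b..N}. \<mu> z)" by (simp add: X_def)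
  show "x \<le> b" if "\<alpha> / 2 \<le> (\<Sum>z\<in>{x..N}. \<mu> z)"
    using that by (intro max) (simp add: X_def)
  show "0 \<le> b" using max X0 by simp
  have "{b<..N} = {b+1..N}" by auto
  then show "(\<Sum>z\<in>{b<..N}. \<mu> z) < \<alpha> / 2"
    using max[of "b + 1"] by (force simp: X_def)
qed

lemma boundary_le_radius: "b \<le> N"
  using tail_boundary \<alpha>_pos by (cases "b \<le> N") auto

text \<open>
  By symmetry the positive and the zero boundary are alike except at the boundary site itself: for
  \<open>b = 0\<close> both sides freeze mass at the single site 0.
\<close>

lemma frozen_mass_eq:
  "frozen_mass \<alpha> \<mu> y =
    (if b < \<bar>y\<bar> then \<mu> y
     else if \<bar>y\<bar> < b then 0
     else if b = 0 then \<alpha> - 2 * (\<Sum>z\<in>{0<..N}. \<mu> z)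
     else \<alpha> / 2 - (\<Sum>z\<in>{b<..N}. \<mu> z))"
proof -
  have "\<mu> \<bar>y\<bar> = \<mu> y" using symmetric by (simp add: abs_if)
  then show ?thesis
    using boundary_nonneg by (auto simp: frozen_mass_def Let_def tail_eq_sum')
qed

lemma frozen_mass_symmetric: "frozen_mass \<alpha> \<mu> (- y) = frozen_mass \<alpha> \<mu> y"
  by (simp add: frozen_mass_eq symmetric)

lemma split_at_boundary: "sum h {b..N} = h b + sum h {b<..N}" for h :: "int \<Rightarrow> real"
proof -
  have "{b..N} = insert b {b<..N}" using boundary_le_radius by auto
  then show ?thesis by simp
qed

lemma frozen_mass_bounds: "0 \<le> frozen_mass \<alpha> \<mu> y" "frozen_mass \<alpha> \<mu> y \<le> \<mu> y"
proof -
  have 1: "\<alpha> / 2 \<le> \<mu> b + (\<Sum>z\<in>{b<..N}. \<mu> z)"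
    using tail_boundary by (simp add: split_at_boundary)
  have 2: "1 = \<mu> 0 + 2 * (\<Sum>z\<in>{0<..N}. \<mu> z)"
    using sum_symmetric_interval[of \<mu> N] symmetric radius_nonneg total by simp
  have 3: "\<mu> y = \<mu> b" if "\<bar>y\<bar> = b"
    using that symmetric[of y] by (auto simp: abs_if split: if_splits)
  show "0 \<le> frozen_mass \<alpha> \<mu> y"
    using nonneg[of y] tail_beyond_boundary by (auto simp: frozen_mass_eq)
  show "frozen_mass \<alpha> \<mu> y \<le> \<mu> y"
    using nonneg[of y] 1 2 3 \<alpha>_less_1 by (auto simp: frozen_mass_eq)
qed

text \<open>
  Equality holds unless \<open>b = 0\<close>, where the site 0 also carries mass frozen from the left side.
\<close>

lemma frozen_mass_right: "\<alpha> / 2 \<le> (\<Sum>z\<in>{b..N}. frozen_mass \<alpha> \<mu> z)"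
proof -
  have "(\<Sum>z\<in>{b<..N}. frozen_mass \<alpha> \<mu> z) = (\<Sum>z\<in>{b<..N}. \<mu> z)"
    using boundary_nonneg by (intro sum.cong) (auto simp: frozen_mass_eq)
  then show ?thesis
    using tail_beyond_boundary boundary_nonneg
    by (auto simp: split_at_boundary frozen_mass_eq)
qed

lemma frozen_mass_total: "(\<Sum>y\<in>{-N..N}. frozen_mass \<alpha> \<mu> y) = \<alpha>"
proof -
  have eq: "(\<Sum>z\<in>{b<..N}. frozen_mass \<alpha> \<mu> z) = (\<Sum>z\<in>{b<..N}. \<mu> z)"
    using boundary_nonneg by (intro sum.cong) (auto simp: frozen_mass_eq)
  have *: "(\<Sum>y\<in>{-N..N}. frozen_mass \<alpha> \<mu> y)
        = frozen_mass \<alpha> \<mu> 0 + 2 * (\<Sum>z\<in>{0<..N}. frozen_mass \<alpha> \<mu> z)"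
    using frozen_mass_symmetric radius_nonneg by (intro sum_symmetric_interval)
  show ?thesis
  proof (cases "b = 0")
    case True
    then show ?thesis using * eq by (simp add: frozen_mass_eq)
  next
    case False
    then have "0 < b" using boundary_nonneg by simp
    then have "(\<Sum>z\<in>{0<..N}. frozen_mass \<alpha> \<mu> z) = (\<Sum>z\<in>{b..N}. frozen_mass \<alpha> \<mu> z)"
      by (intro sum.mono_neutral_right) (auto simp: frozen_mass_eq)
    also have "\<dots> = \<alpha> / 2"
      using \<open>0 < b\<close> by (simp add: split_at_boundary eq) (simp add: frozen_mass_eq)
    finally show ?thesis using * \<open>0 < b\<close> by (simp add: frozen_mass_eq)
  qed
qed

lemma free_mass_outside: "b < \<bar>x\<bar> \<Longrightarrow> free_mass \<alpha> \<mu> x = 0"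
  by (simp add: free_mass_def frozen_mass_eq)

lemma frozen_mass_outside: "N < \<bar>x\<bar> \<Longrightarrow> frozen_mass \<alpha> \<mu> x = 0"
  using boundary_le_radius outside by (simp add: frozen_mass_eq)

lemma free_mass_total: "(\<Sum>x\<in>{-N..N}. free_mass \<alpha> \<mu> x) = 1 - \<alpha>"
  by (simp add: free_mass_def sum_subtractf total frozen_mass_total)

text \<open>
  The adjoint form of a step: instead of spreading the free mass, average the test function over
  the two neighbours. Taking \<open>g = 1\<close> gives conservation of mass and \<open>g = (\<lambda>x. x\<^sup>2)\<close> the
  growth of the second moment.
\<close>

lemma sum_fbd_step:
  fixes g :: "int \<Rightarrow> real"
  shows "(\<Sum>x\<in>{-(N+1)..N+1}. g x * fbd_step \<alpha> \<mu> x)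
       = (\<Sum>x\<in>{-N..N}. (g (x + 1) + g (x - 1)) / 2 * free_mass \<alpha> \<mu> x)
         + (\<Sum>x\<in>{-N..N}. g x * frozen_mass \<alpha> \<mu> x)"
proof -
  have out: "free_mass \<alpha> \<mu> x = 0" if "N < \<bar>x\<bar>" for x
    using that boundary_le_radius by (intro free_mass_outside) simp
  have r: "(\<Sum>x\<in>{-(N+1)..N+1}. g x * free_mass \<alpha> \<mu> (x - 1))
      = (\<Sum>x\<in>{-N..N}. g (x + 1) * free_mass \<alpha> \<mu> x)"
    by (rule sum.reindex_bij_witness_not_neutral
        [of "{-(N+1)..N+1} \<inter> {x. N < \<bar>x - 1\<bar>}" "{}" _ "\<lambda>x. x + 1" "\<lambda>x. x - 1"])
      (auto simp: out)
  have l: "(\<Sum>x\<in>{-(N+1)..N+1}. g x * free_mass \<alpha> \<mu> (x + 1))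
      = (\<Sum>x\<in>{-N..N}. g (x - 1) * free_mass \<alpha> \<mu> x)"
    by (rule sum.reindex_bij_witness_not_neutral
        [of "{-(N+1)..N+1} \<inter> {x. N < \<bar>x + 1\<bar>}" "{}" _ "\<lambda>x. x - 1" "\<lambda>x. x + 1"])
      (auto simp: out)
  have f: "(\<Sum>x\<in>{-(N+1)..N+1}. g x * frozen_mass \<alpha> \<mu> x)
      = (\<Sum>x\<in>{-N..N}. g x * frozen_mass \<alpha> \<mu> x)"
    by (rule sum.mono_neutral_right) (auto simp: frozen_mass_outside)
  have "(\<Sum>x\<in>{-(N+1)..N+1}. g x * fbd_step \<alpha> \<mu> x)
      = ((\<Sum>x\<in>{-(N+1)..N+1}. g x * free_mass \<alpha> \<mu> (x + 1))
         + (\<Sum>x\<in>{-(N+1)..N+1}. g x * free_mass \<alpha> \<mu> (x - 1))) / 2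
        + (\<Sum>x\<in>{-(N+1)..N+1}. g x * frozen_mass \<alpha> \<mu> x)"
    unfolding sum.distrib[symmetric] sum_divide_distrib
    by (intro sum.cong) (auto simp: fbd_step_def field_simps)
  also have "\<dots> = (\<Sum>x\<in>{-N..N}. (g (x + 1) + g (x - 1)) / 2 * free_mass \<alpha> \<mu> x)
        + (\<Sum>x\<in>{-N..N}. g x * frozen_mass \<alpha> \<mu> x)"
    unfolding r l f sum.distrib[symmetric] sum_divide_distrib
    by (intro arg_cong2[where f = "(+)"] sum.cong) (auto simp: field_simps)
  finally show ?thesis .
qed

lemma frozen_mass_le_fbd_step: "frozen_mass \<alpha> \<mu> x \<le> fbd_step \<alpha> \<mu> x"
  using frozen_mass_bounds by (simp add: fbd_step_def free_mass_def)

lemma symmetric_distribution_fbd_step: "symmetric_distribution (N + 1) (fbd_step \<alpha> \<mu>)"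
proof
  show "0 \<le> fbd_step \<alpha> \<mu> x" for x
    using frozen_mass_le_fbd_step[of x] frozen_mass_bounds(1)[of x] by simp
  have "free_mass \<alpha> \<mu> (- x) = free_mass \<alpha> \<mu> x" for x
    by (simp add: free_mass_def symmetric frozen_mass_symmetric)
  from this[of "x - 1" for x] this[of "x + 1" for x]
  show "fbd_step \<alpha> \<mu> (- x) = fbd_step \<alpha> \<mu> x" for x
    by (simp add: fbd_step_def frozen_mass_symmetric add.commute)
  show "fbd_step \<alpha> \<mu> x = 0" if "N + 1 < \<bar>x\<bar>" for x
    using that boundary_le_radius
    by (simp add: fbd_step_def free_mass_outside frozen_mass_outside)
  show "(\<Sum>x\<in>{-(N+1)..N+1}. fbd_step \<alpha> \<mu> x) = 1"
    using sum_fbd_step[of "\<lambda>_. 1"] by (simp add: free_mass_total frozen_mass_total)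
qed

text \<open>
  The average of \<open>(x + 1)\<^sup>2\<close> and \<open>(x - 1)\<^sup>2\<close> exceeds \<open>x\<^sup>2\<close> by 1, so the gain is the
  total free mass.
\<close>

lemma second_moment_fbd_step:
  "(\<Sum>x\<in>{-(N+1)..N+1}. (real_of_int x)\<^sup>2 * fbd_step \<alpha> \<mu> x)
    = (\<Sum>x\<in>{-N..N}. (real_of_int x)\<^sup>2 * \<mu> x) + (1 - \<alpha>)"
proof -
  have "((real_of_int (x + 1))\<^sup>2 + (real_of_int (x - 1))\<^sup>2) / 2 * free_mass \<alpha> \<mu> x
        + (real_of_int x)\<^sup>2 * frozen_mass \<alpha> \<mu> x
      = (real_of_int x)\<^sup>2 * \<mu> x + free_mass \<alpha> \<mu> x" for x
    by (simp add: free_mass_def power2_eq_square field_simps)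
  then show ?thesis
    unfolding sum_fbd_step sum.distrib[symmetric]
    by (simp add: sum.distrib free_mass_total)
qed

text \<open>
  The mass frozen in \<open>{b..}\<close> stays put and already amounts to at least \<open>\<alpha> / 2\<close>.
\<close>

lemma boundary_le_boundary_fbd_step: "b \<le> boundary \<alpha> (fbd_step \<alpha> \<mu>)"
proof -
  interpret step: frozen_boundary "N + 1" "fbd_step \<alpha> \<mu>" \<alpha>
    using symmetric_distribution_fbd_step \<alpha>_pos \<alpha>_less_1
    by (simp add: frozen_boundary_def frozen_boundary_axioms_def)
  have "\<alpha> / 2 \<le> (\<Sum>z\<in>{b..N}. frozen_mass \<alpha> \<mu> z)" by (rule frozen_mass_right)
  also have "\<dots> \<le> (\<Sum>z\<in>{b..N}. fbd_step \<alpha> \<mu> z)"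
    by (intro sum_mono frozen_mass_le_fbd_step)
  also have "\<dots> \<le> (\<Sum>z\<in>{b..N+1}. fbd_step \<alpha> \<mu> z)"
    using step.nonneg by (intro sum_mono2) auto
  finally show ?thesis by (rule step.tail_imp_le_boundary)
qed

text \<open>
  The induction step for the confinement of the diffusion: the newly moved mass reaches at most
  the old \<open>b + 1\<close>, and the boundary does not retreat.
\<close>

lemma fbd_step_outside:
  assumes "\<And>x. b + 1 < \<bar>x\<bar> \<Longrightarrow> \<mu> x = 0"
    and "boundary \<alpha> (fbd_step \<alpha> \<mu>) + 1 < \<bar>x\<bar>"
  shows "fbd_step \<alpha> \<mu> x = 0"
proof -
  have "b + 1 < \<bar>x\<bar>" using assms(2) boundary_le_boundary_fbd_step by simp
  then show ?thesis
    using assms(1)[of x] by (simp add: fbd_step_def free_mass_outside frozen_mass_eq)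
qed

end

section \<open>The diffusion at time t\<close>

lemma fbd_Suc: "fbd \<alpha> (Suc t) = fbd_step \<alpha> (fbd \<alpha> t)"
  by (simp add: fbd_step_def fun_eq_iff)

lemma frozen_boundary_fbd:
  assumes "0 < \<alpha>" "\<alpha> < 1"
  shows "frozen_boundary (int t) (fbd \<alpha> t) \<alpha>"
proof (induction t)
  case 0
  show ?case by unfold_locales (use assms in auto)
next
  case (Suc t)
  then have "symmetric_distribution (int t + 1) (fbd_step \<alpha> (fbd \<alpha> t))"
    by (rule frozen_boundary.symmetric_distribution_fbd_step)
  with assms show ?case
    by (simp only: frozen_boundary_def frozen_boundary_axioms_def fbd_Suc) (simp add: add.commute)
qed

lemma second_moment_fbd:
  assumes "0 < \<alpha>" "\<alpha> < 1"
  shows "(\<Sum>x\<in>{- int t..int t}. (real_of_int x)\<^sup>2 * fbd \<alpha> t x) = (1 - \<alpha>) * real t"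
proof (induction t)
  case (Suc t)
  have "int (Suc t) = int t + 1" by simp
  then show ?case
    using frozen_boundary.second_moment_fbd_step[OF frozen_boundary_fbd[OF assms, of t]] Suc
    by (simp only: fbd_Suc) (simp add: algebra_simps)
qed auto

lemma fbd_outside:
  assumes "0 < \<alpha>" "\<alpha> < 1" and "fbd_boundary \<alpha> t + 1 < \<bar>x\<bar>"
  shows "fbd \<alpha> t x = 0"
  using assms(3)
proof (induction t arbitrary: x)
  case 0
  interpret frozen_boundary "int 0" "fbd \<alpha> 0" \<alpha>
    by (rule frozen_boundary_fbd[OF assms(1,2)])
  from 0 show ?case using boundary_nonneg by (auto simp: fbd_boundary_def)
next
  case (Suc t)
  interpret frozen_boundary "int t" "fbd \<alpha> t" \<alpha>
    by (rule frozen_boundary_fbd[OF assms(1,2)])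
  from Suc show ?case
    unfolding fbd_boundary_def fbd_Suc by (intro fbd_step_outside)
qed

text \<open>
  A probability distribution confined to \<open>\<bar>x\<bar> \<le> \<beta>\<^sub>t + 1\<close> has second moment at most
  \<open>(\<beta>\<^sub>t + 1)\<^sup>2\<close>.
\<close>

lemma fbd_boundary_lower:
  assumes "0 < \<alpha>" "\<alpha> < 1"
  shows "(1 - \<alpha>) * real t \<le> (real_of_int (fbd_boundary \<alpha> t + 1))\<^sup>2"
proof -
  interpret frozen_boundary "int t" "fbd \<alpha> t" \<alpha>
    by (rule frozen_boundary_fbd[OF assms])
  let ?B = "real_of_int (fbd_boundary \<alpha> t + 1)"
  have "(real_of_int x)\<^sup>2 * fbd \<alpha> t x \<le> ?B\<^sup>2 * fbd \<alpha> t x" for x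
  proof (cases "fbd_boundary \<alpha> t + 1 < \<bar>x\<bar>")
    case True
    then show ?thesis using fbd_outside[OF assms] by simp
  next
    case False
    then have "\<bar>real_of_int x\<bar> \<le> ?B" by linarith
    then have "(real_of_int x)\<^sup>2 \<le> ?B\<^sup>2" using abs_le_square_iff by fastforce
    then show ?thesis using nonneg by (rule mult_right_mono)
  qed
  then have "(\<Sum>x\<in>{- int t..int t}. (real_of_int x)\<^sup>2 * fbd \<alpha> t x)
      \<le> (\<Sum>x\<in>{- int t..int t}. ?B\<^sup>2 * fbd \<alpha> t x)"
    by (intro sum_mono)
  then show ?thesis
    by (simp only: second_moment_fbd[OF assms] sum_distrib_left[symmetric] total mult_1_right)
qed

section \<open>The rescaled distribution functions\<close>

lemma cdf_fbd_rescaled: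
  assumes "0 < \<alpha>" "\<alpha> < 1"
  shows "cdf (fbd_rescaled \<alpha> t) y
    = (\<Sum>z\<in>{- int t..int t} \<inter> {z. real_of_int z / sqrt (real t) \<le> y}. fbd \<alpha> t z)"
proof -
  interpret frozen_boundary "int t" "fbd \<alpha> t" \<alpha>
    by (rule frozen_boundary_fbd[OF assms])
  let ?P = "\<lambda>z. real_of_int z / sqrt (real t) \<le> y"
  let ?M = "point_measure UNIV (\<lambda>x. ennreal (fbd \<alpha> t x))"
  have pos: "z \<in> {- int t..int t}" if "fbd \<alpha> t z > 0" for z
    using outside[of z] that by (cases "int t < \<bar>z\<bar>") auto
  have fin: "finite {z. ?P z \<and> 0 < fbd \<alpha> t z}"
    by (rule finite_subset[of _ "{- int t..int t}"]) (use pos in auto)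
  have "emeasure (fbd_rescaled \<alpha> t) {..y} = emeasure ?M {z. ?P z}"
    unfolding fbd_rescaled_def
    by (subst emeasure_distr) (auto simp: space_point_measure vimage_def)
  also have "\<dots> = (\<Sum>z\<in>{z. ?P z \<and> 0 < fbd \<alpha> t z}. ennreal (fbd \<alpha> t z))"
    by (subst emeasure_point_measure) (use fin in auto)
  also have "\<dots> = (\<Sum>z\<in>{- int t..int t} \<inter> {z. ?P z}. ennreal (fbd \<alpha> t z))"
    by (rule sum.mono_neutral_left) (use pos in \<open>auto simp: ennreal_eq_0_iff\<close>)
  also have "\<dots> = ennreal (\<Sum>z\<in>{- int t..int t} \<inter> {z. ?P z}. fbd \<alpha> t z)"
    using nonneg by (intro sum_ennreal)
  finally show ?thesis
    using nonneg by (simp add: cdf_def measure_def sum_nonneg)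
qed

lemma cdf_fbd_rescaled_right:
  assumes "0 < \<alpha>" "\<alpha> < 1" and "real_of_int (fbd_boundary \<alpha> t + 1) / sqrt (real t) \<le> y"
  shows "cdf (fbd_rescaled \<alpha> t) y = 1"
proof -
  interpret frozen_boundary "int t" "fbd \<alpha> t" \<alpha>
    by (rule frozen_boundary_fbd[OF assms(1,2)])
  have "fbd \<alpha> t z = 0" if "\<not> real_of_int z / sqrt (real t) \<le> y" for z
  proof -
    have "\<not> z \<le> fbd_boundary \<alpha> t + 1"
    proof
      assume "z \<le> fbd_boundary \<alpha> t + 1"
      then have "real_of_int z / sqrt (real t)
          \<le> real_of_int (fbd_boundary \<alpha> t + 1) / sqrt (real t)"
        by (intro divide_right_mono) auto
      with assms(3) that show False by simp
    qed
    then show ?thesis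
      using assms by (intro fbd_outside) auto
  qed
  then have "cdf (fbd_rescaled \<alpha> t) y = (\<Sum>z\<in>{- int t..int t}. fbd \<alpha> t z)"
    unfolding cdf_fbd_rescaled[OF assms(1,2)]
    by (intro sum.mono_neutral_left) auto
  then show ?thesis by (simp only: total)
qed

lemma cdf_fbd_rescaled_left:
  assumes "0 < \<alpha>" "\<alpha> < 1" and "y < real_of_int (fbd_boundary \<alpha> t) / sqrt (real t)"
  shows "cdf (fbd_rescaled \<alpha> t) y \<le> 1 - \<alpha> / 2"
proof -
  interpret frozen_boundary "int t" "fbd \<alpha> t" \<alpha>
    by (rule frozen_boundary_fbd[OF assms(1,2)])
  let ?L = "{- int t..int t} \<inter> {z. real_of_int z / sqrt (real t) \<le> y}"
  have less: "z < b" if "z \<in> ?L" for z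
  proof (rule ccontr)
    assume "\<not> z < b"
    then have "real_of_int (fbd_boundary \<alpha> t) / sqrt (real t) \<le> real_of_int z / sqrt (real t)"
      by (intro divide_right_mono) (auto simp: fbd_boundary_def)
    with assms(3) that show False by simp
  qed
  have "(\<Sum>z\<in>?L. fbd \<alpha> t z) \<le> (\<Sum>z\<in>{- int t..<b}. fbd \<alpha> t z)"
    using nonneg less by (intro sum_mono2) auto
  moreover have "(\<Sum>z\<in>{- int t..int t}. fbd \<alpha> t z)
      = (\<Sum>z\<in>{- int t..<b}. fbd \<alpha> t z) + (\<Sum>z\<in>{b..int t}. fbd \<alpha> t z)"
    using boundary_nonneg boundary_le_radius
    by (subst sum.union_disjoint[symmetric]) (auto intro!: sum.cong)
  ultimately show ?thesis
    using tail_boundary by (simp only: cdf_fbd_rescaled[OF assms(1,2)] total)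
qed

section \<open>Convergence of the boundary\<close>

lemma (in finite_borel_measure) ex_isCont_cdf_between:
  assumes "x < y"
  obtains z where "x < z" "z < y" "isCont (cdf M) z"
proof -
  have "countable {z. \<not> isCont (cdf M) z}"
    using countable_atoms by (simp add: isCont_cdf zero_less_measure_iff)
  then have "\<not> {x<..<y} \<subseteq> {z. \<not> isCont (cdf M) z}"
    using uncountable_open_interval[of x y] assms countable_subset by blast
  then show ?thesis using that by auto
qed

text \<open>
  Think of \<open>r t\<close> as the right edge of the support of \<open>M t\<close>, up to a vanishing error \<open>e t\<close>, with mass
  at least \<open>c\<close> sitting at the edge. The distribution function of \<open>M t\<close> then never takes values
  strictly between \<open>1 - c\<close> and 1 outside the short interval from \<open>r t\<close> to \<open>r t + e t\<close>, which is
  what pins the edge down: at a continuity point \<open>x\<close> of the limit, a limiting value above \<open>1 - c\<close>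
  forces \<open>r t \<le> x\<close> eventually, while a limiting value below 1 forces \<open>x < r t + e t\<close>
  eventually. Since \<open>0 < c\<close>, at least one alternative holds at every continuity point, and the limit
  of \<open>r\<close> is the point where the limiting distribution function first exceeds \<open>1 - c\<close>.
  The condition \<open>c < 1\<close> makes that point finite.
\<close>

lemma convergent_of_edge_atom:
  fixes M :: "nat \<Rightarrow> real measure" and r e :: "nat \<Rightarrow> real"
  assumes "real_distribution L" "weak_conv_m M L"
    and "0 < c" "c < 1" and "e \<longlonglongrightarrow> 0"
    and right: "\<And>t y. r t + e t \<le> y \<Longrightarrow> cdf (M t) y = 1"
    and left: "\<And>t y. y < r t \<Longrightarrow> cdf (M t) y \<le> 1 - c"
  shows "\<exists>l. r \<longlonglongrightarrow> l"
proof -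
  interpret real_distribution L by fact
  have conv: "(\<lambda>t. cdf (M t) x) \<longlonglongrightarrow> cdf L x" if "isCont (cdf L) x" for x
    using assms(2) that by (simp add: weak_conv_m_def weak_conv_def)
  define X where "X = {x. 1 - c < cdf L x}"
  define l where "l = Inf X"
  have "eventually (\<lambda>x. 1 - c < cdf L x) at_top"
    using cdf_lim_at_top_prob \<open>0 < c\<close> by (intro order_tendstoD) auto
  then have "X \<noteq> {}"
    unfolding X_def using eventually_happens trivial_limit_at_top_linorder by blast
  have "eventually (\<lambda>x. cdf L x < 1 - c) at_bot"
    using cdf_lim_at_bot \<open>c < 1\<close> by (intro order_tendstoD) auto
  then obtain a where a: "cdf L x < 1 - c" if "x \<le> a" for x
    by (auto simp: eventually_at_bot_linorder)
  have "a \<le> x" if "x \<in> X" for x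
    using a[of x] that by (cases "a \<le> x") (auto simp: X_def)
  then have "bdd_below X" by (rule bdd_belowI)
  have "r \<longlonglongrightarrow> l"
  proof (rule order_tendstoI)
    fix y assume "y < l"
    \<comment> \<open>The gap between \<open>y\<close> and \<open>z\<close> absorbs the error \<open>e t\<close>.\<close>
    then obtain z z' where z: "y < z" "z < z'" "z' < l"
      by (meson dense)
    obtain x where x: "z < x" "x < z'" "isCont (cdf L) x"
      using ex_isCont_cdf_between \<open>z < z'\<close> by blast
    have "x \<notin> X"
      using cInf_lower[OF _ \<open>bdd_below X\<close>, of x] x z by (auto simp: l_def)
    then have "cdf L x < 1" using \<open>0 < c\<close> by (simp add: X_def)
    then have "\<forall>\<^sub>F t in sequentially. cdf (M t) x < 1"
      using conv[OF x(3)] by (intro order_tendstoD)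
    moreover have "\<forall>\<^sub>F t in sequentially. e t < z - y"
      using \<open>e \<longlonglongrightarrow> 0\<close> z by (intro order_tendstoD) auto
    ultimately show "\<forall>\<^sub>F t in sequentially. y < r t"
    proof eventually_elim
      case (elim t)
      then have "x < r t + e t" using right[of t x] by force
      with elim x show ?case by simp
    qed
  next
    fix y assume "l < y"
    then obtain w where w: "w \<in> X" "w < y"
      using cInf_lessD[OF \<open>X \<noteq> {}\<close>] by (auto simp: l_def)
    obtain x where x: "w < x" "x < y" "isCont (cdf L) x"
      using ex_isCont_cdf_between \<open>w < y\<close> by blast
    have "1 - c < cdf L x"
      using w cdf_nondecreasing[of w x] x by (simp add: X_def)
    then have "\<forall>\<^sub>F t in sequentially. 1 - c < cdf (M t) x"
      using conv[OF x(3)] by (intro order_tendstoD)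
    then show "\<forall>\<^sub>F t in sequentially. r t < y"
    proof eventually_elim
      case (elim t)
      then have "r t \<le> x" using left[of x t] by force
      with x show ?case by simp
    qed
  qed
  then show ?thesis ..
qed

theorem lemma4:
  assumes "\<forall>\<alpha>::real. 0 < \<alpha> \<and> \<alpha> < 1 \<longrightarrow>
             (\<exists>\<mu>_inf. real_distribution \<mu>_inf \<and> weak_conv_m (\<lambda>t. fbd_rescaled \<alpha> t) \<mu>_inf)"
  shows "\<forall>\<alpha>::real. 0 < \<alpha> \<and> \<alpha> < 1 \<longrightarrow>
           (\<exists>l>0. (\<lambda>t. real_of_int (fbd_boundary \<alpha> t) / sqrt (real t)) \<longlonglongrightarrow> l)"
proof (intro allI impI)
  fix \<alpha> :: real
  assume "0 < \<alpha> \<and> \<alpha> < 1"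
  then have \<alpha>: "0 < \<alpha>" "\<alpha> < 1" by auto
  then obtain L where L: "real_distribution L" "weak_conv_m (\<lambda>t. fbd_rescaled \<alpha> t) L"
    using assms by blast
  let ?r = "\<lambda>t. real_of_int (fbd_boundary \<alpha> t) / sqrt (real t)"
  let ?e = "\<lambda>t. 1 / sqrt (real t)"
  have e: "?e \<longlonglongrightarrow> 0" by real_asymp
  have "\<exists>l. ?r \<longlonglongrightarrow> l"
  proof (rule convergent_of_edge_atom[OF L, of "\<alpha> / 2" ?e])
    show "cdf (fbd_rescaled \<alpha> t) y = 1" if "?r t + ?e t \<le> y" for t y
      using that by (intro cdf_fbd_rescaled_right \<alpha>) (simp add: add_divide_distrib)
    show "cdf (fbd_rescaled \<alpha> t) y \<le> 1 - \<alpha> / 2" if "y < ?r t" for t y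
      using that by (intro cdf_fbd_rescaled_left \<alpha>)
  qed (use \<alpha> e in auto)
  then obtain l where l: "?r \<longlonglongrightarrow> l" ..
  have "sqrt (1 - \<alpha>) \<le> ?r t + ?e t" if "0 < t" for t
  proof -
    interpret frozen_boundary "int t" "fbd \<alpha> t" \<alpha>
      by (rule frozen_boundary_fbd[OF \<alpha>])
    have "sqrt ((1 - \<alpha>) * real t) \<le> real_of_int (fbd_boundary \<alpha> t + 1)"
      using fbd_boundary_lower[OF \<alpha>] boundary_nonneg
      by (intro real_le_lsqrt) (auto simp: fbd_boundary_def)
    then have "sqrt (1 - \<alpha>) * sqrt (real t) \<le> real_of_int (fbd_boundary \<alpha> t + 1)"
      by (simp only: real_sqrt_mult)
    with that show ?thesis
      by (simp add: field_simps)
  qed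
  then have "\<forall>\<^sub>F t in sequentially. sqrt (1 - \<alpha>) \<le> ?r t + ?e t"
    using eventually_gt_at_top[of 0] by (rule eventually_mono[rotated])
  moreover have "(\<lambda>t. ?r t + ?e t) \<longlonglongrightarrow> l"
    using tendsto_add[OF l e] by simp
  ultimately have "sqrt (1 - \<alpha>) \<le> l"
    by (intro tendsto_lowerbound) auto
  moreover have "0 < sqrt (1 - \<alpha>)" using \<alpha> by simp
  ultimately have "0 < l" by (rule less_le_trans[rotated])
  with l show "\<exists>l>0. ?r \<longlonglongrightarrow> l" by blast
qed

end
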